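(* Let $(A,\{B_i\}_{i=1}^N,\{Q_{i,d}\}_{i=1}^N,\{R_{ij,d}\}_{i,j=1}^N)$ be the observed LQ game, and let $Q_i^*$, $R_{ij}$, $K_i^*$ ($i,j=1,\dots,N$) be the output of the model-based inverse reinforcement learning algorithm (Algorithm 1, described in full in the context) applied to demonstrated Nash equilibrium trajectories of the observed game, with $F_i^*=R_{ii}^{-1}B_i^\top K_i^*$. Write $\Delta Q_i=Q_i^*-Q_i'$, $\Delta K_i=K_i^*-K_i'$, $\Delta R_{ij}=R_{ij}-R_{ij}'$. Set $\Delta K_i=0$ and $\Delta R_{ii}=0$ for $i=1,\dots,N$ (i.e., $K_i'=K_i^*$ and $R_{ii}'=R_{ii}$). Then every choice of symmetric $Q_i'$ and $R_{ij}'$, $i,j=1,\dots,N$, $j\neq i$, satisfying $$(Q_i^*-Q_i')+\sum_{j=1,\,j\neq i}^N F_j^{*\top}(R_{ij}-R_{ij}')F_j^*=0,\qquad i=1,\dots,N,$$ together with $R_{ii}'$ and the dynamics $(A,B_1,\dots,B_N)$, forms a new game $(A,\{B_i\}_{i=1}^N,\{Q_i'\}_{i=1}^N,\{R_{ij}'\}_{i,j=1}^N)$ equivalent to the observed game $(A,\{B_i\}_{i=1}^N,\{Q_{i,d}\}_{i=1}^N,\{R_{ij,d}\}_{i,j=1}^N)$.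
   Context: LQ games. An $N$-player LQ differential game $(A,\{B_i\},\{Q_i\},\{R_{ij}\})$ has dynamics $\dot x=Ax+\sum_{i=1}^N B_iu_i$, $x\in\mathbb R^n$, $u_i\in\mathbb R^{m_i}$, and costs $J_i=\int_0^\infty (x^\top Q_ix+\sum_{j=1}^N u_j^\top R_{ij}u_j)\,dt$, with $Q_i\in\mathbb R^{n\times n}$, $R_{ij}\in\mathbb R^{m_j\times m_j}$ symmetric and $R_{ii}>0$. Its algebraic Riccati equations (AREs) are, for $i=1,\dots,N$, $$A^\top K_i+K_iA+Q_i+\sum_{j} F_j^\top R_{ij}F_j-\Big(\sum_{j} F_j^\top B_j^\top\Big)K_i-K_i\Big(\sum_{j} B_jF_j\Big)=0,\qquad F_j=R_{jj}^{-1}B_j^\top K_j,$$ in the unknown symmetric matrices $K_1,\dots,K_N\in\mathbb R^{n\times n}$. A solution is stabilizing if $A-\sum_j B_jF_j$ is stable (all eigenvalues have negative real part). The feedback controls are $u_i=-F_ix$. Observed game. Its cost matrices $Q_{i,d},R_{ij,d}$ are symmetric with $R_{ii,d}>0$ and are unknown; $A,B_1,\dots,B_N$ are known. The demonstrated trajectories $(x_d,u_{1,d},\dots,u_{N,d})$ are Nash equilibrium trajectories: $u_{i,d}=-F_{i,d}x_d$ with $F_{i,d}=R_{ii,d}^{-1}B_i^\top K_{i,d}$, where $\{K_{i,d}\}_{i=1}^N$ is a symmetric stabilizing solution of the AREs of the observed game. Equivalent game. A game $(A,\{B_i\},\{Q_i\},\{R_{ij}\})$ is equivalent to the observed game if its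 AREs have a stabilizing solution $\{K_i\}$ with $R_{ii}^{-1}B_i^\top K_i=R_{ii,d}^{-1}B_i^\top K_{i,d}$ (i.e., $F_i=F_{i,d}$) for all $i=1,\dots,N$. Algorithm 1. (1) Initialize symmetric $R_{ii}>0$, $R_{ij}\ge0$ ($i\ne j$), $Q_i^{(0)}>0$. The $R_{ij}$ stay fixed throughout. Sample the demonstrated trajectories at $t_1,\dots,t_s$, $s\ge n$, to get $\hat x_d=[x_d(t_1),\dots,x_d(t_s)]$ and $\hat u_{i,d}=[u_{i,d}(t_1),\dots,u_{i,d}(t_s)]$ with $\hat x_d\hat x_d^\top$ of rank $n$. (2) Compute $\hat F_i=-\hat u_{i,d}\hat x_d^\top(\hat x_d\hat x_d^\top)^{-1}$ (so $\hat F_i=F_{i,d}$). (3) Set $F_i^{(0,0)}=\hat F_i$ and, for $k=0,1,\dots$, solve for $K_i^{(k+1,0)}$ the Lyapunov equations $$\Big(A-\sum_j B_jF_j^{(k,0)}\Big)^\top K_i^{(k+1,0)}+K_i^{(k+1,0)}\Big(A-\sum_j B_jF_j^{(k,0)}\Big)=-\Big(Q_i^{(0)}+\sum_j F_j^{(k,0)\top}R_{ij}F_j^{(k,0)}\Big)$$ and set $F_i^{(k+1,0)}=R_{ii}^{-1}B_i^\top K_i^{(k+1,0)}$, until $\|K_i^{(k+1,0)}-K_i^{(k,0)}\|<\epsilon_i$ for small constants $\epsilon_i>0$. (4) Let $K_i^{(0)},F_i^{(0)}$ be the final values from (3). For $p=0,1,\dots$ put $d_i^{(p)}=F_i^{(p)}-\hat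 F_i$. (5) Update, with learning rates $\alpha_i\ge 0$, $$K_i^{(p+1)}=K_i^{(p)}-\alpha_i\big(d_i^{(p)\top}R_{ii}^{-1}B_i^\top+B_iR_{ii}^{-1}d_i^{(p)}\big),\qquad F_i^{(p+1)}=R_{ii}^{-1}B_i^\top K_i^{(p+1)}.$$ (6) Set $$Q_i^{(p+1)}=-A^\top K_i^{(p+1)}-K_i^{(p+1)}A-\sum_j F_j^{(p+1)\top}R_{ij}F_j^{(p+1)}+\Big(\sum_j F_j^{(p+1)\top}B_j^\top\Big)K_i^{(p+1)}+K_i^{(p+1)}\Big(\sum_j B_jF_j^{(p+1)}\Big).$$ (7) Increase $p$ by 1 and repeat (4)–(6) until $\operatorname{tr}(d_i^{(p)\top}d_i^{(p)})<\delta_i$ for small constants $\delta_i>0$. Output. $K_i^*$ and $Q_i^*$ denote the results of convergence of $K_i^{(p)}$ and $Q_i^{(p)}$ as $p\to\infty$; the output consists of $Q_i^*,K_i^*$ and the initialized $R_{ij}$. The source states for this output that $\{K_i^*\}$ is a stabilizing solution of the AREs of $(A,\{B_i\},\{Q_i^*\},\{R_{ij}\})$ and that $F_i^*=R_{ii}^{-1}B_i^\top K_i^*=\hat F_i=F_{i,d}$. *)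

theory Defs
  imports
    Complex_Main
    "Jordan_Normal_Form.Char_Poly"
    "Jordan_Normal_Form.Gauss_Jordan_Elimination"
    "Jordan_Normal_Form.DL_Rank"
begin

text \<open>
  Players are the numbers \<open>1, \<dots>, N\<close>. The control dimension \<open>m i\<close> varies with the player, so
  matrices are carrier-based: \<open>A\<close> is \<open>n \<times> n\<close>, \<open>B i\<close> is \<open>n \<times> m i\<close>, \<open>Q i\<close> is \<open>n \<times> n\<close> and
  \<open>R i j\<close> is \<open>m j \<times> m j\<close>. Values of these families at indices outside \<open>{1..N}\<close> play no role.
\<close>

subsection \<open>Matrices\<close>

text \<open>Meaningful only for an invertible square matrix; unspecified otherwise.\<close>
definition mat_inv :: "real mat \<Rightarrow> real mat" where
  "mat_inv M = the (mat_inverse M)"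

text \<open>The dimensions are parameters because matrices of varying size form no monoid type.\<close>
definition mat_sum :: "nat \<Rightarrow> nat \<Rightarrow> nat set \<Rightarrow> (nat \<Rightarrow> real mat) \<Rightarrow> real mat" where
  "mat_sum nr nc I f = mat nr nc (\<lambda>rc. \<Sum>j\<in>I. f j $$ rc)"

definition mat_trace :: "real mat \<Rightarrow> real" where
  "mat_trace M = (\<Sum>r<dim_row M. M $$ (r, r))"

definition frobenius_norm :: "real mat \<Rightarrow> real" where
  "frobenius_norm M = sqrt (mat_trace (M\<^sup>T * M))"

definition sym_mat :: "nat \<Rightarrow> real mat \<Rightarrow> bool" where
  "sym_mat k M \<longleftrightarrow> M \<in> carrier_mat k k \<and> M\<^sup>T = M"

definition pos_def :: "nat \<Rightarrow> real mat \<Rightarrow> bool" where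
  "pos_def k M \<longleftrightarrow> sym_mat k M \<and> (\<forall>v\<in>carrier_vec k. v \<noteq> 0\<^sub>v k \<longrightarrow> v \<bullet> (M *\<^sub>v v) > 0)"

definition pos_semidef :: "nat \<Rightarrow> real mat \<Rightarrow> bool" where
  "pos_semidef k M \<longleftrightarrow> sym_mat k M \<and> (\<forall>v\<in>carrier_vec k. v \<bullet> (M *\<^sub>v v) \<ge> 0)"

definition stable_mat :: "real mat \<Rightarrow> bool" where
  "stable_mat M \<longleftrightarrow> (\<forall>l. eigenvalue (map_mat complex_of_real M) l \<longrightarrow> Re l < 0)"

definition mat_tendsto :: "nat \<Rightarrow> nat \<Rightarrow> (nat \<Rightarrow> real mat) \<Rightarrow> real mat \<Rightarrow> bool" where
  "mat_tendsto nr nc X L \<longleftrightarrow> L \<in> carrier_mat nr nc \<and>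
     (\<forall>r<nr. \<forall>c<nc. (\<lambda>p. X p $$ (r, c)) \<longlonglongrightarrow> L $$ (r, c))"

subsection \<open>LQ games and their algebraic Riccati equations\<close>

text \<open>
  The costs \<open>J\<^sub>i\<close> are the integrals over \<open>[0, \<infinity>)\<close> of
  \<open>x\<^sup>T Q\<^sub>i x + \<Sum>\<^sub>j u\<^sub>j\<^sup>T R\<^sub>i\<^sub>j u\<^sub>j\<close>; a game is represented by its data \<open>(A, B, Q, R)\<close>.
\<close>
definition lq_game ::
  "nat \<Rightarrow> (nat \<Rightarrow> nat) \<Rightarrow> nat \<Rightarrow> real mat \<Rightarrow> (nat \<Rightarrow> real mat) \<Rightarrow> (nat \<Rightarrow> real mat) \<Rightarrow>
   (nat \<Rightarrow> nat \<Rightarrow> real mat) \<Rightarrow> bool" where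
  "lq_game n m N A B Q R \<longleftrightarrow>
     A \<in> carrier_mat n n \<and>
     (\<forall>i\<in>{1..N}. B i \<in> carrier_mat n (m i) \<and> sym_mat n (Q i) \<and> pos_def (m i) (R i i) \<and>
        (\<forall>j\<in>{1..N}. sym_mat (m j) (R i j)))"

definition gain ::
  "(nat \<Rightarrow> real mat) \<Rightarrow> (nat \<Rightarrow> nat \<Rightarrow> real mat) \<Rightarrow> (nat \<Rightarrow> real mat) \<Rightarrow> nat \<Rightarrow> real mat" where
  "gain B R K i = mat_inv (R i i) * (B i)\<^sup>T * K i"

definition closed_loop ::
  "nat \<Rightarrow> nat \<Rightarrow> real mat \<Rightarrow> (nat \<Rightarrow> real mat) \<Rightarrow> (nat \<Rightarrow> real mat) \<Rightarrow> real mat" where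
  "closed_loop n N A B F = A - mat_sum n n {1..N} (\<lambda>j. B j * F j)"

definition are_lhs ::
  "nat \<Rightarrow> nat \<Rightarrow> real mat \<Rightarrow> (nat \<Rightarrow> real mat) \<Rightarrow> (nat \<Rightarrow> real mat) \<Rightarrow>
   (nat \<Rightarrow> nat \<Rightarrow> real mat) \<Rightarrow> (nat \<Rightarrow> real mat) \<Rightarrow> nat \<Rightarrow> real mat" where
  "are_lhs n N A B Q R K i =
     (let F = gain B R K in
      A\<^sup>T * K i + K i * A + Q i
      + mat_sum n n {1..N} (\<lambda>j. (F j)\<^sup>T * R i j * F j)
      - mat_sum n n {1..N} (\<lambda>j. (F j)\<^sup>T * (B j)\<^sup>T) * K i
      - K i * mat_sum n n {1..N} (\<lambda>j. B j * F j))"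

definition stabilizing_are_solution ::
  "nat \<Rightarrow> nat \<Rightarrow> real mat \<Rightarrow> (nat \<Rightarrow> real mat) \<Rightarrow> (nat \<Rightarrow> real mat) \<Rightarrow>
   (nat \<Rightarrow> nat \<Rightarrow> real mat) \<Rightarrow> (nat \<Rightarrow> real mat) \<Rightarrow> bool" where
  "stabilizing_are_solution n N A B Q R K \<longleftrightarrow>
     (\<forall>i\<in>{1..N}. sym_mat n (K i) \<and> are_lhs n N A B Q R K i = 0\<^sub>m n n) \<and>
     stable_mat (closed_loop n N A B (gain B R K))"

text \<open>
  \<open>(A, B, Q, R)\<close> is equivalent to an observed game with the same dynamics, whose control weights
  are \<open>Rd\<close> and whose demonstrated equilibrium is given by the stabilizing solution \<open>Kd\<close>.
\<close>
definition equivalent_game ::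
  "nat \<Rightarrow> nat \<Rightarrow> real mat \<Rightarrow> (nat \<Rightarrow> real mat) \<Rightarrow> (nat \<Rightarrow> real mat) \<Rightarrow>
   (nat \<Rightarrow> nat \<Rightarrow> real mat) \<Rightarrow> (nat \<Rightarrow> nat \<Rightarrow> real mat) \<Rightarrow> (nat \<Rightarrow> real mat) \<Rightarrow> bool" where
  "equivalent_game n N A B Q R Rd Kd \<longleftrightarrow>
     (\<exists>K. stabilizing_are_solution n N A B Q R K \<and>
        (\<forall>i\<in>{1..N}. gain B R K i = gain B Rd Kd i))"

text \<open>
  \<open>x\<close> and \<open>u i\<close> solve the dynamics on \<open>[0, \<infinity>)\<close> (componentwise, one-sided derivative at \<open>0\<close>) under
  the feedback controls \<open>u\<^sub>i = - F\<^sub>i x\<close>.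
\<close>
definition feedback_trajectory ::
  "nat \<Rightarrow> nat \<Rightarrow> real mat \<Rightarrow> (nat \<Rightarrow> real mat) \<Rightarrow> (nat \<Rightarrow> real mat) \<Rightarrow>
   (real \<Rightarrow> real vec) \<Rightarrow> (nat \<Rightarrow> real \<Rightarrow> real vec) \<Rightarrow> bool" where
  "feedback_trajectory n N A B F x u \<longleftrightarrow>
     (\<forall>t\<ge>0. x t \<in> carrier_vec n \<and>
        (\<forall>r<n. ((\<lambda>\<tau>. x \<tau> $ r) has_real_derivative
                 (A *\<^sub>v x t) $ r + (\<Sum>j=1..N. (B j *\<^sub>v u j t) $ r)) (at t within {0..})) \<and>
        (\<forall>i\<in>{1..N}. u i t = - (F i *\<^sub>v x t)))"

subsection \<open>The inverse reinforcement learning algorithm\<close>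

definition sample_mat :: "nat \<Rightarrow> nat \<Rightarrow> (nat \<Rightarrow> real) \<Rightarrow> (real \<Rightarrow> real vec) \<Rightarrow> real mat" where
  "sample_mat k s t y = mat_of_cols k (map (\<lambda>l. y (t l)) [1..<Suc s])"

definition estimated_gain ::
  "nat \<Rightarrow> (nat \<Rightarrow> nat) \<Rightarrow> nat \<Rightarrow> (nat \<Rightarrow> real) \<Rightarrow> (real \<Rightarrow> real vec) \<Rightarrow>
   (nat \<Rightarrow> real \<Rightarrow> real vec) \<Rightarrow> nat \<Rightarrow> real mat" where
  "estimated_gain n m s t x u i =
     (let X = sample_mat n s t x; U = sample_mat (m i) s t (u i)
      in - (U * X\<^sup>T * mat_inv (X * X\<^sup>T)))"

text \<open>
  Step (3): \<open>KL k i\<close> and \<open>FL k i\<close> are the iterates with upper index \<open>(k, 0)\<close>, and \<open>KL (Suc k)\<close> is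
  the one accepted by the stopping test. Since \<open>KL 0\<close> enters only that test and is given no value
  by the algorithm, it is an arbitrary matrix. Any \<open>k\<close> passing the test is admitted (in
  particular the first), so the choice of matrix norm, here the Frobenius norm, is immaterial.
\<close>
definition lyapunov_phase ::
  "nat \<Rightarrow> nat \<Rightarrow> real mat \<Rightarrow> (nat \<Rightarrow> real mat) \<Rightarrow> (nat \<Rightarrow> real mat) \<Rightarrow>
   (nat \<Rightarrow> nat \<Rightarrow> real mat) \<Rightarrow> (nat \<Rightarrow> real mat) \<Rightarrow> (nat \<Rightarrow> real) \<Rightarrow> (nat \<Rightarrow> real mat) \<Rightarrow> bool" where
  "lyapunov_phase n N A B Q0 R Fhat \<epsilon> K0 \<longleftrightarrow>
     (\<exists>KL FL k.
        (\<forall>i\<in>{1..N}. FL 0 i = Fhat i \<and> KL 0 i \<in> carrier_mat n n) \<and>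
        (\<forall>l\<le>k. \<forall>i\<in>{1..N}.
           sym_mat n (KL (Suc l) i) \<and>
           (closed_loop n N A B (FL l))\<^sup>T * KL (Suc l) i + KL (Suc l) i * closed_loop n N A B (FL l)
             = - (Q0 i + mat_sum n n {1..N} (\<lambda>j. (FL l j)\<^sup>T * R i j * FL l j)) \<and>
           FL (Suc l) i = gain B R (KL (Suc l)) i) \<and>
        (\<forall>i\<in>{1..N}. frobenius_norm (KL (Suc k) i - KL k i) < \<epsilon> i) \<and>
        (\<forall>i\<in>{1..N}. K0 i = KL (Suc k) i))"

text \<open>Steps (4)--(6): \<open>K p i\<close> and \<open>Q p i\<close> are the iterates with upper index \<open>(p)\<close>.\<close>
definition update_phase ::
  "nat \<Rightarrow> nat \<Rightarrow> real mat \<Rightarrow> (nat \<Rightarrow> real mat) \<Rightarrow> (nat \<Rightarrow> nat \<Rightarrow> real mat) \<Rightarrow>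
   (nat \<Rightarrow> real mat) \<Rightarrow> (nat \<Rightarrow> real) \<Rightarrow> (nat \<Rightarrow> nat \<Rightarrow> real mat) \<Rightarrow> (nat \<Rightarrow> nat \<Rightarrow> real mat) \<Rightarrow> bool" where
  "update_phase n N A B R Fhat \<alpha> K Q \<longleftrightarrow>
     (\<forall>p. \<forall>i\<in>{1..N}.
        (let d = gain B R (K p) i - Fhat i; F = gain B R (K (Suc p)) in
           K (Suc p) i = K p i - \<alpha> i \<cdot>\<^sub>m (d\<^sup>T * mat_inv (R i i) * (B i)\<^sup>T + B i * mat_inv (R i i) * d) \<and>
           Q (Suc p) i =
             - (A\<^sup>T * K (Suc p) i) - K (Suc p) i * A
             - mat_sum n n {1..N} (\<lambda>j. (F j)\<^sup>T * R i j * F j)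
             + mat_sum n n {1..N} (\<lambda>j. (F j)\<^sup>T * (B j)\<^sup>T) * K (Suc p) i
             + K (Suc p) i * mat_sum n n {1..N} (\<lambda>j. B j * F j)))"

text \<open>
  \<open>Qs\<close>, \<open>R\<close>, \<open>Ks\<close> are an output of the algorithm run on the demonstrated trajectories \<open>x\<close>, \<open>u\<close>.
  The output is the limit \<open>p \<rightarrow> \<infinity>\<close>, so the tolerances \<open>\<delta>\<close> of the stopping test in step (7) are not
  fixed parameters of the run: convergence of the algorithm means that the iterates converge and
  that the test is met for every choice of positive tolerances. The latter does not follow from
  convergence of the iterates: for instance with \<open>\<alpha> i = 0\<close>, or with \<open>N = 1\<close>, \<open>B 1 = 1\<close>,
  \<open>R 1 1 = 1\<close> and a non-symmetric gain to be matched, \<open>d\<close> need not tend to \<open>0\<close>.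
\<close>
definition irl_output ::
  "nat \<Rightarrow> (nat \<Rightarrow> nat) \<Rightarrow> nat \<Rightarrow> real mat \<Rightarrow> (nat \<Rightarrow> real mat) \<Rightarrow>
   (real \<Rightarrow> real vec) \<Rightarrow> (nat \<Rightarrow> real \<Rightarrow> real vec) \<Rightarrow>
   (nat \<Rightarrow> real mat) \<Rightarrow> (nat \<Rightarrow> nat \<Rightarrow> real mat) \<Rightarrow> (nat \<Rightarrow> real mat) \<Rightarrow> bool" where
  "irl_output n m N A B x u Qs R Ks \<longleftrightarrow>
     (\<exists>s t \<epsilon> \<alpha> K Q.
        let Fhat = estimated_gain n m s t x u; X = sample_mat n s t x in
          (\<forall>i\<in>{1..N}. pos_def (m i) (R i i) \<and> pos_def n (Q 0 i) \<and>
             (\<forall>j\<in>{1..N} - {i}. pos_semidef (m j) (R i j))) \<and>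
          s \<ge> n \<and> (\<forall>l\<in>{1..s}. t l \<ge> 0) \<and> vec_space.rank n (X * X\<^sup>T) = n \<and>
          (\<forall>i\<in>{1..N}. \<epsilon> i > 0 \<and> \<alpha> i \<ge> 0) \<and>
          lyapunov_phase n N A B (Q 0) R Fhat \<epsilon> (K 0) \<and>
          update_phase n N A B R Fhat \<alpha> K Q \<and>
          (\<forall>\<delta>. (\<forall>i\<in>{1..N}. \<delta> i > 0) \<longrightarrow>
             (\<exists>p. \<forall>i\<in>{1..N}.
                let d = gain B R (K p) i - Fhat i in mat_trace (d\<^sup>T * d) < \<delta> i)) \<and>
          (\<forall>i\<in>{1..N}. mat_tendsto n n (\<lambda>p. K p i) (Ks i) \<and>
                        mat_tendsto n n (\<lambda>p. Q p i) (Qs i)))"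

end

theory Submission
  imports Defs
begin

text \<open>
  The sampled gains equal the demonstrated ones because \<open>X X\<^sup>T\<close> is invertible. An iterate at which
  every gain mismatch vanishes is a fixed point of the update; hence, whether or not such an iterate
  occurs, meeting the stopping test at all tolerances forces the mismatch to vanish in the limit, so
  \<open>F\<^sub>i\<^sup>* = F\<^sub>i\<^sub>,\<^sub>d\<close>. Passing to the limit in step (6) gives the AREs for \<open>(Q\<^sup>*, R, K\<^sup>*)\<close>.
  With \<open>K\<^sup>*\<close> and the \<open>R\<^sub>i\<^sub>i\<close> kept, the gains do not change, and the balance condition says that the
  AREs change by zero.
\<close>

subsection \<open>Matrix inverses and gains\<close>

lemma mat_inv_inverse:
  assumes "M \<in> carrier_mat k k" "det M \<noteq> 0"
  shows "mat_inv M \<in> carrier_mat k k" "M * mat_inv M = 1\<^sub>m k" "mat_inv M * M = 1\<^sub>m k"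
proof -
  \<comment> \<open>A nonzero determinant makes \<open>M\<close> a unit of the matrix ring, so
    Gauss-Jordan elimination succeeds and the \<open>the\<close> in \<open>mat_inv\<close> picks a
    genuine two-sided inverse.\<close>
  have "mat_inverse M \<noteq> None"
    using mat_inverse(1)[OF assms(1), of "()"] det_non_zero_imp_unit[OF assms, of "()"] by blast
  then obtain B where "mat_inverse M = Some B" by blast
  with mat_inverse(2)[OF assms(1) this]
  show "mat_inv M \<in> carrier_mat k k" "M * mat_inv M = 1\<^sub>m k" "mat_inv M * M = 1\<^sub>m k"
    by (auto simp: mat_inv_def)
qed

text \<open>A singular matrix has a nonzero kernel vector, at which the quadratic form would be zero
  instead of positive.\<close>

lemma pos_def_det_nonzero:
  assumes "pos_def k M" shows "det M \<noteq> 0"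
proof
  assume "det M = 0"
  moreover have M: "M \<in> carrier_mat k k" using assms by (auto simp: pos_def_def sym_mat_def)
  ultimately obtain v where v: "v \<in> carrier_vec k" "v \<noteq> 0\<^sub>v k" "M *\<^sub>v v = 0\<^sub>v k"
    using det_0_iff_vec_prod_zero_field by blast
  with assms have "v \<bullet> (M *\<^sub>v v) > 0" by (auto simp: pos_def_def)
  with v show False by simp
qed

lemma sym_mat_mat_inv:
  assumes "sym_mat k M" "det M \<noteq> 0"
  shows "sym_mat k (mat_inv M)"
proof -
  let ?V = "mat_inv M"
  have M: "M \<in> carrier_mat k k" "M\<^sup>T = M" using assms by (auto simp: sym_mat_def)
  note V = mat_inv_inverse[OF M(1) assms(2)]
  \<comment> \<open>Transposing \<open>M * ?V = 1\<close> turns the transpose of \<open>?V\<close>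
    into a left inverse of the symmetric \<open>M\<close>; a left inverse must agree with the right
    inverse \<open>?V\<close>.\<close>
  have VM: "?V\<^sup>T * M = 1\<^sub>m k"
    using transpose_mult[OF M(1) V(1)] V(2) M(2) by simp
  have "?V\<^sup>T = ?V\<^sup>T * (M * ?V)" using V by simp
  also have "\<dots> = (?V\<^sup>T * M) * ?V" using V M by (intro assoc_mult_mat[symmetric]) auto
  also have "\<dots> = ?V" using VM V by simp
  finally show ?thesis using V by (simp add: sym_mat_def)
qed

lemma gain_carrier:
  assumes R: "R i i \<in> carrier_mat k k" "det (R i i) \<noteq> 0" and B: "B i \<in> carrier_mat n k"
    and K: "K i \<in> carrier_mat n n"
  shows "gain B R K i \<in> carrier_mat k n"
proof -
  have "(B i)\<^sup>T \<in> carrier_mat k n" using B by simp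
  from mult_carrier_mat[OF mult_carrier_mat[OF mat_inv_inverse(1)[OF R] this] K]
  show ?thesis unfolding gain_def .
qed

section \<open>Finite sums of matrices and Gram traces\<close>

lemma mat_sum_carrier [simp]: "mat_sum nr nc I f \<in> carrier_mat nr nc"
  by (simp add: mat_sum_def)

lemma mat_sum_dim [simp]: "dim_row (mat_sum nr nc I f) = nr" "dim_col (mat_sum nr nc I f) = nc"
  by (simp_all add: mat_sum_def)

lemma mat_sum_index [simp]:
  "r < nr \<Longrightarrow> c < nc \<Longrightarrow> mat_sum nr nc I f $$ (r, c) = (\<Sum>j\<in>I. f j $$ (r, c))"
  by (simp add: mat_sum_def)

lemma mat_sum_cong:
  "(\<And>j. j \<in> I \<Longrightarrow> f j = g j) \<Longrightarrow> mat_sum nr nc I f = mat_sum nr nc I g"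
  unfolding mat_sum_def by (intro cong_mat) auto

text \<open>This is the squared Frobenius norm, so the stopping test controls every entry of the
  gain mismatch.\<close>

lemma mat_trace_gram:
  "mat_trace (M\<^sup>T * M) = (\<Sum>c<dim_col M. \<Sum>r<dim_row M. (M $$ (r, c))\<^sup>2)"
  by (simp add: mat_trace_def scalar_prod_def power2_eq_square atLeast0LessThan)

lemma mat_trace_gram_nonneg: "0 \<le> mat_trace (M\<^sup>T * M)"
  unfolding mat_trace_gram by (intro sum_nonneg) auto

lemma mat_trace_gram_zero:
  assumes "M \<in> carrier_mat nr nc"
  shows "mat_trace (M\<^sup>T * M) = 0 \<longleftrightarrow> M = 0\<^sub>m nr nc"
proof
  assume "mat_trace (M\<^sup>T * M) = 0"
  with assms have "\<forall>c<nc. \<forall>r<nr. M $$ (r, c) = 0"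
    unfolding mat_trace_gram by (auto simp: sum_nonneg_eq_0_iff sum_nonneg)
  with assms show "M = 0\<^sub>m nr nc" by (intro eq_matI) auto
next
  assume "M = 0\<^sub>m nr nc"
  then show "mat_trace (M\<^sup>T * M) = 0" unfolding mat_trace_gram by simp
qed

subsection \<open>Limits of matrices\<close>

lemma mat_tendsto_const: "M \<in> carrier_mat nr nc \<Longrightarrow> mat_tendsto nr nc (\<lambda>_. M) M"
  by (simp add: mat_tendsto_def)

lemma mat_tendsto_transpose:
  assumes "mat_tendsto nr nc X L" "\<And>p. X p \<in> carrier_mat nr nc"
  shows "mat_tendsto nc nr (\<lambda>p. (X p)\<^sup>T) L\<^sup>T"
proof -
  have "dim_row (X p) = nr" "dim_col (X p) = nc" for p using assms(2)[of p] by auto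
  with assms(1) show ?thesis by (auto simp: mat_tendsto_def)
qed

lemma mat_tendsto_mult:
  assumes X: "mat_tendsto nr k X L" "\<And>p. X p \<in> carrier_mat nr k"
    and Y: "mat_tendsto k nc Y M" "\<And>p. Y p \<in> carrier_mat k nc"
  shows "mat_tendsto nr nc (\<lambda>p. X p * Y p) (L * M)"
proof -
  have dims: "dim_row (X p) = nr" "dim_col (X p) = k" "dim_row (Y p) = k" "dim_col (Y p) = nc" for p
    using X(2)[of p] Y(2)[of p] by auto
  have "(\<lambda>p. (X p * Y p) $$ (r, c)) \<longlonglongrightarrow> (L * M) $$ (r, c)" if "r < nr" "c < nc" for r c
    using X(1) Y(1) that dims
    by (auto simp: mat_tendsto_def scalar_prod_def intro!: tendsto_sum tendsto_mult)
  with X Y show ?thesis by (auto simp: mat_tendsto_def)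
qed

text \<open>Matrix addition takes its dimensions from the second summand; this is why the carrier
  condition is placed on \<open>Y\<close>. Subtraction below follows the same convention.\<close>

lemma mat_tendsto_add:
  assumes "mat_tendsto nr nc X L" "mat_tendsto nr nc Y M" "\<And>p. Y p \<in> carrier_mat nr nc"
  shows "mat_tendsto nr nc (\<lambda>p. X p + Y p) (L + M)"
proof -
  have "dim_row (Y p) = nr" "dim_col (Y p) = nc" for p using assms(3)[of p] by auto
  with assms(1,2) show ?thesis by (auto simp: mat_tendsto_def intro!: tendsto_add)
qed

lemma mat_tendsto_minus:
  assumes "mat_tendsto nr nc X L" "mat_tendsto nr nc Y M" "\<And>p. Y p \<in> carrier_mat nr nc"
  shows "mat_tendsto nr nc (\<lambda>p. X p - Y p) (L - M)"
proof -
  have "dim_row (Y p) = nr" "dim_col (Y p) = nc" for p using assms(3)[of p] by auto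
  with assms(1,2) show ?thesis by (auto simp: mat_tendsto_def intro!: tendsto_diff)
qed

lemma mat_tendsto_uminus:
  assumes "mat_tendsto nr nc X L" "\<And>p. X p \<in> carrier_mat nr nc"
  shows "mat_tendsto nr nc (\<lambda>p. - X p) (- L)"
proof -
  have "dim_row (X p) = nr" "dim_col (X p) = nc" for p using assms(2)[of p] by auto
  with assms(1) show ?thesis by (auto simp: mat_tendsto_def intro!: tendsto_minus)
qed

lemma mat_tendsto_sum:
  assumes "\<And>j. j \<in> I \<Longrightarrow> mat_tendsto nr nc (\<lambda>p. X p j) (L j)"
  shows "mat_tendsto nr nc (\<lambda>p. mat_sum nr nc I (X p)) (mat_sum nr nc I L)"
  using assms by (auto simp: mat_tendsto_def intro!: tendsto_sum)

lemma mat_tendsto_unique: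
  assumes "mat_tendsto nr nc X L" "mat_tendsto nr nc X M"
  shows "L = M"
proof -
  have "L $$ (r, c) = M $$ (r, c)" if "r < nr" "c < nc" for r c
    using assms that LIMSEQ_unique unfolding mat_tendsto_def by blast
  with assms show ?thesis by (intro eq_matI) (auto simp: mat_tendsto_def)
qed

lemma mat_tendsto_Suc:
  assumes "mat_tendsto nr nc X L" shows "mat_tendsto nr nc (\<lambda>p. X (Suc p)) L"
  using assms unfolding mat_tendsto_def by (auto intro: LIMSEQ_Suc)

text \<open>Transposition is continuous, so a sequence of symmetric matrices tends both to
  \<open>L\<close> and to its transpose, and limits are unique.\<close>

lemma mat_tendsto_sym_mat:
  assumes lim: "mat_tendsto k k X L" and sym: "\<And>p. sym_mat k (X p)"
  shows "sym_mat k L"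
proof -
  have L: "L \<in> carrier_mat k k" using lim by (simp add: mat_tendsto_def)
  have "mat_tendsto k k (\<lambda>p. (X p)\<^sup>T) L\<^sup>T"
    using sym by (intro mat_tendsto_transpose lim) (auto simp: sym_mat_def)
  then have "mat_tendsto k k X L\<^sup>T" using sym by (simp add: sym_mat_def)
  from mat_tendsto_unique[OF this lim] L show ?thesis by (simp add: sym_mat_def)
qed

lemma mat_trace_gram_tendsto:
  assumes "mat_tendsto nr nc X L" "\<And>p. X p \<in> carrier_mat nr nc"
  shows "(\<lambda>p. mat_trace ((X p)\<^sup>T * X p)) \<longlonglongrightarrow> mat_trace (L\<^sup>T * L)"
proof -
  have "dim_row (X p) = nr" "dim_col (X p) = nc" for p using assms(2)[of p] by auto
  moreover have "dim_row L = nr" "dim_col L = nc" using assms(1) by (auto simp: mat_tendsto_def)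
  ultimately show ?thesis using assms(1)
    by (auto simp: mat_trace_gram mat_tendsto_def intro!: tendsto_sum tendsto_power)
qed

text \<open>The gain is left multiplication by the fixed matrix
  \<open>mat_inv (R i i) * (B i)\<^sup>T\<close>, hence continuous in \<open>K\<close>.\<close>

lemma mat_tendsto_gain:
  assumes R: "R i i \<in> carrier_mat k k" "det (R i i) \<noteq> 0" and B: "B i \<in> carrier_mat n k"
    and K: "\<And>p. K p i \<in> carrier_mat n n" "mat_tendsto n n (\<lambda>p. K p i) (L i)"
  shows "mat_tendsto k n (\<lambda>p. gain B R (K p) i) (gain B R L i)"
proof -
  have "mat_inv (R i i) * (B i)\<^sup>T \<in> carrier_mat k n"
    using mat_inv_inverse(1)[OF R] B by (intro mult_carrier_mat[where n = k]) simp_all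
  from mat_tendsto_mult[OF mat_tendsto_const[OF this] this K(2,1)]
  show ?thesis unfolding gain_def .
qed

section \<open>Vanishing of the gain mismatch in the limit\<close>

text \<open>Small values alone say nothing about the tail, since one early zero would meet every
  tolerance; absorption makes the whole tail zero in that case. If no value is zero, any finite
  initial segment is bounded away from zero, so small values occur arbitrarily late and exclude a
  positive limit.\<close>

lemma limit_zero_of_small_values:
  fixes g :: "nat \<Rightarrow> real"
  assumes lim: "g \<longlonglongrightarrow> G" and nonneg: "\<And>p. 0 \<le> g p"
    and absorbing: "\<And>p. g p = 0 \<Longrightarrow> g (Suc p) = 0"
    and small: "\<And>e. e > 0 \<Longrightarrow> \<exists>p. g p < e"
  shows "G = 0"
proof (cases "\<exists>p. g p = 0")
  case True
  then obtain p where p: "g p = 0" by blast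
  have "g (k + p) = 0" for k by (induction k) (use p absorbing in auto)
  then have "(\<lambda>k. g (k + p)) \<longlonglongrightarrow> 0" by simp
  moreover have "(\<lambda>k. g (k + p)) \<longlonglongrightarrow> G" using lim by (rule LIMSEQ_ignore_initial_segment)
  ultimately show ?thesis by (rule LIMSEQ_unique[symmetric])
next
  case False
  with nonneg have pos: "g p > 0" for p by (metis order_le_less)
  show ?thesis
  proof (rule ccontr)
    assume "G \<noteq> 0"
    moreover have "G \<ge> 0" using lim nonneg by (intro LIMSEQ_le_const) auto
    ultimately have G: "G > 0" by simp
    then have "\<forall>\<^sub>F p in sequentially. G / 2 < g p" by (intro order_tendstoD(1)[OF lim]) auto
    then obtain P where P: "\<And>p. p \<ge> P \<Longrightarrow> G / 2 < g p" by (auto simp: eventually_sequentially)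
    \<comment> \<open>No index attains a value below this \<open>e\<close>: values before
      \<open>P\<close> are at least \<open>e\<close> by the minimum, later ones exceed
      \<open>G / 2\<close>. It is positive because only finitely many positive numbers enter, and
      inserting \<open>G / 2\<close> covers \<open>P = 0\<close>.\<close>
    define e where "e = Min (insert (G / 2) (g ` {..<P}))"
    have "e > 0" using G pos by (auto simp: e_def)
    with small obtain p where p: "g p < e" by blast
    have "e \<le> G / 2" unfolding e_def by (intro Min_le) auto
    then have "p < P" using P[of p] p by (cases "P \<le> p") auto
    then have "e \<le> g p" by (auto simp: e_def intro!: Min_le)
    with p show False by simp
  qed
qed

text \<open>Adding the squared mismatches of all players yields one nonnegative scalar sequence,
  which vanishes exactly when all players match. The scalar lemma makes the limit sum zero, and
  nonnegativity splits this back into the single players.\<close>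

lemma mismatch_limit_zero:
  assumes d: "\<And>p i. i \<in> {1..N} \<Longrightarrow> d p i \<in> carrier_mat (m i) n"
    and lim: "\<And>i. i \<in> {1..N} \<Longrightarrow> mat_tendsto (m i) n (\<lambda>p. d p i) (D i)"
    and absorbing: "\<And>p i. (\<And>j. j \<in> {1..N} \<Longrightarrow> d p j = 0\<^sub>m (m j) n) \<Longrightarrow> i \<in> {1..N}
      \<Longrightarrow> d (Suc p) i = 0\<^sub>m (m i) n"
    and small: "\<And>\<delta>. (\<And>i. i \<in> {1..N} \<Longrightarrow> \<delta> i > 0) \<Longrightarrow>
      \<exists>p. \<forall>i\<in>{1..N}. mat_trace ((d p i)\<^sup>T * d p i) < \<delta> i"
    and i: "i \<in> {1..N::nat}"
  shows "D i = 0\<^sub>m (m i) n"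
proof -
  define g where "g p = (\<Sum>i=1..N. mat_trace ((d p i)\<^sup>T * d p i))" for p
  have g0: "g p = 0 \<longleftrightarrow> (\<forall>i\<in>{1..N}. d p i = 0\<^sub>m (m i) n)" for p
  proof -
    have "g p = 0 \<longleftrightarrow> (\<forall>i\<in>{1..N}. mat_trace ((d p i)\<^sup>T * d p i) = 0)"
      unfolding g_def by (intro sum_nonneg_eq_0_iff) (auto intro: mat_trace_gram_nonneg)
    then show ?thesis using mat_trace_gram_zero[OF d] by blast
  qed
  have "(\<Sum>i=1..N. mat_trace ((D i)\<^sup>T * D i)) = 0"
  proof (rule limit_zero_of_small_values[of g])
    show "g \<longlonglongrightarrow> (\<Sum>i=1..N. mat_trace ((D i)\<^sup>T * D i))"
      unfolding g_def using lim d by (intro tendsto_sum mat_trace_gram_tendsto) auto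
    show "0 \<le> g p" for p unfolding g_def by (intro sum_nonneg mat_trace_gram_nonneg)
    show "g (Suc p) = 0" if "g p = 0" for p using that absorbing unfolding g0 by blast
    show "\<exists>p. g p < e" if e: "e > 0" for e
    proof -
      \<comment> \<open>Equal shares \<open>e / real N\<close> add up to \<open>e\<close>. The fixed
        \<open>i\<close> guarantees that there is a player, so the shares are positive and the
        summed inequality is strict.\<close>
      obtain p where "\<forall>i\<in>{1..N}. mat_trace ((d p i)\<^sup>T * d p i) < e / real N"
        using small[of "\<lambda>_. e / real N"] i e by auto
      then have "g p < (\<Sum>i=1..N. e / real N)" unfolding g_def using i
        by (intro sum_strict_mono) auto
      also have "\<dots> = e" using i by simp
      finally show ?thesis by blast
    qed
  qed
  then have "mat_trace ((D i)\<^sup>T * D i) = 0"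
    using i by (simp add: sum_nonneg_eq_0_iff mat_trace_gram_nonneg)
  moreover have "D i \<in> carrier_mat (m i) n" using lim[OF i] by (simp add: mat_tendsto_def)
  ultimately show ?thesis using mat_trace_gram_zero by blast
qed

subsection \<open>The algorithm\<close>

text \<open>Columnwise the feedback law reads \<open>U = - (F * X)\<close>, so the least-squares
  formula becomes \<open>F * (X * X\<^sup>T)\<close> times the inverse of the Gram matrix, which
  exists by the rank condition.\<close>

lemma estimated_gain_eq:
  assumes F: "F \<in> carrier_mat (m i) n"
    and x: "\<And>l. l \<in> {1..s} \<Longrightarrow> x (t l) \<in> carrier_vec n"
    and u: "\<And>l. l \<in> {1..s} \<Longrightarrow> u i (t l) = - (F *\<^sub>v x (t l))"
    and rank: "vec_space.rank n (sample_mat n s t x * (sample_mat n s t x)\<^sup>T) = n"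
  shows "estimated_gain n m s t x u i = F"
proof -
  define X where "X = sample_mat n s t x"
  define U where "U = sample_mat (m i) s t (u i)"
  let ?G = "X * X\<^sup>T"
  have X: "X \<in> carrier_mat n s" by (auto simp: X_def sample_mat_def mat_of_cols_def)
  have U: "U = - (F * X)"
  proof (rule eq_matI)
    fix r c assume "r < dim_row (- (F * X))" "c < dim_col (- (F * X))"
    then have rc: "r < m i" "c < s" using F X by auto
    \<comment> \<open>Columns are counted from 0 and sampling times from 1: column \<open>c\<close>
      holds sample \<open>Suc c\<close>.\<close>
    then have [simp]: "[Suc 0..<Suc s] ! c = Suc c" by (simp del: upt_Suc)
    have xc: "x (t (Suc c)) \<in> carrier_vec n" using x[of "Suc c"] rc by auto
    have col: "col X c = x (t (Suc c))" using rc xc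
      unfolding X_def sample_mat_def by (subst col_mat_of_cols) (auto simp del: upt_Suc)
    have "U $$ (r, c) = u i (t (Suc c)) $ r"
      using rc by (simp add: U_def sample_mat_def mat_of_cols_def del: upt_Suc)
    also have "\<dots> = - (F * X) $$ (r, c)"
      using rc F X u[of "Suc c"] col by auto
    also have "\<dots> = (- (F * X)) $$ (r, c)" using rc F X by auto
    finally show "U $$ (r, c) = (- (F * X)) $$ (r, c)" .
  qed (use F X in \<open>auto simp: U_def sample_mat_def mat_of_cols_def simp del: upt_Suc\<close>)
  have G: "?G \<in> carrier_mat n n" using X by auto
  have "det ?G \<noteq> 0" using rank vec_space.det_rank_iff[OF G] by (simp add: X_def)
  note V = mat_inv_inverse[OF G this]
  have "U * X\<^sup>T * mat_inv ?G = - (F * X * X\<^sup>T * mat_inv ?G)"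
    unfolding U using F X V by simp
  also have "F * X * X\<^sup>T * mat_inv ?G = F * (?G * mat_inv ?G)"
  proof -
    have "F * X * X\<^sup>T = F * ?G" using F X by (intro assoc_mult_mat) auto
    moreover have "F * ?G * mat_inv ?G = F * (?G * mat_inv ?G)"
      using F G V(1) by (intro assoc_mult_mat) auto
    ultimately show ?thesis by simp
  qed
  also have "\<dots> = F" using F V by simp
  finally show ?thesis
    using F unfolding estimated_gain_def Let_def X_def[symmetric] U_def[symmetric] by simp
qed

text \<open>Since \<open>V\<close> is symmetric, the two terms of the correction are transposes of
  each other, and \<open>S + S\<^sup>T\<close> is symmetric for every square
  \<open>S\<close>.\<close>

lemma sym_mat_update:
  assumes K: "sym_mat n K" and V: "sym_mat k V" and B: "B \<in> carrier_mat n k"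
    and d: "d \<in> carrier_mat k n"
  shows "sym_mat n (K - a \<cdot>\<^sub>m (d\<^sup>T * V * B\<^sup>T + B * V * d))"
proof -
  have V': "V \<in> carrier_mat k k" "V\<^sup>T = V" using V by (auto simp: sym_mat_def)
  have K': "K \<in> carrier_mat n n" "K\<^sup>T = K" using K by (auto simp: sym_mat_def)
  have 1: "(d\<^sup>T * V * B\<^sup>T)\<^sup>T = B * V * d"
  proof -
    have "(d\<^sup>T * V * B\<^sup>T)\<^sup>T = B * (V * d)"
      using V' B d transpose_mult[of "d\<^sup>T * V" n k "B\<^sup>T" n] transpose_mult[of "d\<^sup>T" n k V k] by simp
    also have "\<dots> = B * V * d" using V' B d by (intro assoc_mult_mat[symmetric]) auto
    finally show ?thesis .
  qed
  define S where "S = d\<^sup>T * V * B\<^sup>T"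
  have S: "S \<in> carrier_mat n n" using V' B d by (auto simp: S_def)
  have eq: "B * V * d = S\<^sup>T" using 1 by (simp add: S_def)
  have "(K - a \<cdot>\<^sub>m (S + S\<^sup>T)) $$ (r, c) = (K - a \<cdot>\<^sub>m (S + S\<^sup>T)) $$ (c, r)" if "r < n" "c < n" for r c
  proof -
    have "K $$ (r, c) = K $$ (c, r)" using K' that by (metis carrier_matD index_transpose_mat(1))
    then show ?thesis using that S K' by simp
  qed
  then show ?thesis using S K' unfolding S_def[symmetric] eq sym_mat_def
    by (auto intro!: eq_matI)
qed

section \<open>The Riccati expression and changes of the cost data\<close>

text \<open>The formula assumed for \<open>Qs i\<close> is the Riccati equation of player
  \<open>i\<close> solved for the state cost, so substituting it cancels every term.\<close>

lemma are_lhs_zero_of_limit: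
  assumes A: "A \<in> carrier_mat n n" and Ks: "Ks i \<in> carrier_mat n n"
    and Q: "Qs i = - (A\<^sup>T * Ks i) - Ks i * A
      - mat_sum n n {1..N} (\<lambda>j. (gain B R Ks j)\<^sup>T * R i j * gain B R Ks j)
      + mat_sum n n {1..N} (\<lambda>j. (gain B R Ks j)\<^sup>T * (B j)\<^sup>T) * Ks i
      + Ks i * mat_sum n n {1..N} (\<lambda>j. B j * gain B R Ks j)"
  shows "are_lhs n N A B Qs R Ks i = 0\<^sub>m n n"
proof -
  have cancel: "U + V + (- U - V - S + T + W) + S - T - W = 0\<^sub>m n n"
    if "U \<in> carrier_mat n n" "V \<in> carrier_mat n n" "S \<in> carrier_mat n n"
      "T \<in> carrier_mat n n" "W \<in> carrier_mat n n" for U V S T W :: "real mat"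
    using that by (intro eq_matI) auto
  show ?thesis unfolding are_lhs_def Let_def Q
    by (intro cancel mult_carrier_mat[OF _ Ks] mult_carrier_mat[OF Ks] mat_sum_carrier)
      (use A in simp_all)
qed

text \<open>With equal gains and equal \<open>K i\<close>, the two expressions differ only in the
  state cost and the quadratic sum over the control weights; the balance condition makes these two
  changes compensate.\<close>

lemma are_lhs_balance:
  assumes A: "A \<in> carrier_mat n n" and K: "K i \<in> carrier_mat n n"
    and F: "\<And>j. j \<in> {1..N} \<Longrightarrow> gain B R K j \<in> carrier_mat (m j) n"
    and R: "\<And>j. j \<in> {1..N} \<Longrightarrow> R i j \<in> carrier_mat (m j) (m j)"
    and R': "\<And>j. j \<in> {1..N} \<Longrightarrow> R' i j \<in> carrier_mat (m j) (m j)"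
    and Q: "Q i \<in> carrier_mat n n" and Q': "Q' i \<in> carrier_mat n n"
    and gains: "\<And>j. j \<in> {1..N} \<Longrightarrow> gain B R' K' j = gain B R K j"
    and K': "K' i = K i" and Rii: "R' i i = R i i" and i: "i \<in> {1..N}"
    and balance: "(Q i - Q' i)
      + mat_sum n n ({1..N} - {i}) (\<lambda>j. (gain B R K j)\<^sup>T * (R i j - R' i j) * gain B R K j) = 0\<^sub>m n n"
  shows "are_lhs n N A B Q' R' K' i = are_lhs n N A B Q R K i"
proof -
  let ?F = "gain B R K"
  let ?S = "mat_sum n n {1..N} (\<lambda>j. (?F j)\<^sup>T * R i j * ?F j)"
  let ?S' = "mat_sum n n {1..N} (\<lambda>j. (?F j)\<^sup>T * R' i j * ?F j)"
  have diff: "(?F j)\<^sup>T * (R i j - R' i j) * ?F j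
      = (?F j)\<^sup>T * R i j * ?F j - (?F j)\<^sup>T * R' i j * ?F j" if j: "j \<in> {1..N}" for j
  proof -
    have "(?F j)\<^sup>T * (R i j - R' i j) = (?F j)\<^sup>T * R i j - (?F j)\<^sup>T * R' i j"
      using F[OF j] R[OF j] R'[OF j] by (intro mult_minus_distrib_mat) auto
    moreover have "((?F j)\<^sup>T * R i j - (?F j)\<^sup>T * R' i j) * ?F j
      = (?F j)\<^sup>T * R i j * ?F j - (?F j)\<^sup>T * R' i j * ?F j"
      using F[OF j] R[OF j] R'[OF j]
      by (intro minus_mult_distrib_mat[of _ n "m j"] mult_carrier_mat[of _ n "m j"]) simp_all
    ultimately show ?thesis by simp
  qed
  have QS: "Q' i + ?S' = Q i + ?S"
  proof (rule eq_matI)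
    fix r c assume "r < dim_row (Q i + ?S)" "c < dim_col (Q i + ?S)"
    then have rc: "r < n" "c < n" by auto
    let ?f = "\<lambda>j. ((?F j)\<^sup>T * R i j * ?F j) $$ (r, c)"
    let ?f' = "\<lambda>j. ((?F j)\<^sup>T * R' i j * ?F j) $$ (r, c)"
    have "0 = Q i $$ (r, c) - Q' i $$ (r, c)
        + (\<Sum>j\<in>{1..N} - {i}. ((?F j)\<^sup>T * (R i j - R' i j) * ?F j) $$ (r, c))"
      using arg_cong[OF balance, of "\<lambda>M. M $$ (r, c)"] rc Q Q' by simp
    also have "(\<Sum>j\<in>{1..N} - {i}. ((?F j)\<^sup>T * (R i j - R' i j) * ?F j) $$ (r, c))
        = (\<Sum>j\<in>{1..N} - {i}. ?f j - ?f' j)"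
    proof (rule sum.cong[OF refl])
      fix j assume "j \<in> {1..N} - {i}"
      then have j: "j \<in> {1..N}" by simp
      show "((?F j)\<^sup>T * (R i j - R' i j) * ?F j) $$ (r, c) = ?f j - ?f' j"
        unfolding diff[OF j] using F[OF j] rc by (intro index_minus_mat(1)) auto
    qed
    \<comment> \<open>The index \<open>j = i\<close>, missing from the balance sum, contributes zero
      because \<open>R' i i = R i i\<close>.\<close>
    also have "\<dots> = (\<Sum>j=1..N. ?f j - ?f' j)"
      using Rii by (intro sum.mono_neutral_left) auto
    finally show "(Q' i + ?S') $$ (r, c) = (Q i + ?S) $$ (r, c)"
      using rc by (simp add: sum_subtractf)
  qed auto
  have sums: "mat_sum n n {1..N} (\<lambda>j. (gain B R' K' j)\<^sup>T * R' i j * gain B R' K' j) = ?S'"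
    "mat_sum n n {1..N} (\<lambda>j. (gain B R' K' j)\<^sup>T * (B j)\<^sup>T) = mat_sum n n {1..N} (\<lambda>j. (?F j)\<^sup>T * (B j)\<^sup>T)"
    "mat_sum n n {1..N} (\<lambda>j. B j * gain B R' K' j) = mat_sum n n {1..N} (\<lambda>j. B j * ?F j)"
    using gains by (auto intro!: mat_sum_cong)
  have AK: "A\<^sup>T * K i + K i * A \<in> carrier_mat n n" using A K by auto
  have "A\<^sup>T * K i + K i * A + Q' i + ?S' = A\<^sup>T * K i + K i * A + Q i + ?S"
    using assoc_add_mat[OF AK Q' mat_sum_carrier] assoc_add_mat[OF AK Q mat_sum_carrier] QS by simp
  then show ?thesis unfolding are_lhs_def Let_def sums K' by simp
qed

text \<open>This collects all that the theorem takes from a run. Stability is not among the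
  conclusions; it is inherited from the observed closed loop once the gains are known to
  agree.\<close>

lemma irl_output_properties:
  assumes A: "A \<in> carrier_mat n n"
    and carriers: "\<forall>i\<in>{1..N}. B i \<in> carrier_mat n (m i)" "\<forall>i\<in>{1..N}. Fd i \<in> carrier_mat (m i) n"
    and demonstration: "feedback_trajectory n N A B Fd x u"
    and alg: "irl_output n m N A B x u Qs R Ks"
    and i: "i \<in> {1..N}"
  shows "pos_def (m i) (R i i)" and "\<And>j. j \<in> {1..N} \<Longrightarrow> sym_mat (m j) (R i j)"
    and "sym_mat n (Ks i)" and "Qs i \<in> carrier_mat n n"
    and "gain B R Ks i = Fd i" and "are_lhs n N A B Qs R Ks i = 0\<^sub>m n n"
proof -
  note B = carriers(1)[rule_format] and Fd = carriers(2)[rule_format]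
  from alg obtain s t \<epsilon> \<alpha> K Q where
    weights: "\<forall>i\<in>{1..N}. pos_def (m i) (R i i) \<and> pos_def n (Q 0 i) \<and>
      (\<forall>j\<in>{1..N} - {i}. pos_semidef (m j) (R i j))"
    and t: "\<forall>l\<in>{1..s}. t l \<ge> 0"
    and rank: "vec_space.rank n (sample_mat n s t x * (sample_mat n s t x)\<^sup>T) = n"
    and lyap: "lyapunov_phase n N A B (Q 0) R (estimated_gain n m s t x u) \<epsilon> (K 0)"
    and upd: "update_phase n N A B R (estimated_gain n m s t x u) \<alpha> K Q"
    and test: "\<forall>\<delta>. (\<forall>i\<in>{1..N}. \<delta> i > 0) \<longrightarrow> (\<exists>p. \<forall>i\<in>{1..N}.
      mat_trace ((gain B R (K p) i - estimated_gain n m s t x u i)\<^sup>T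
        * (gain B R (K p) i - estimated_gain n m s t x u i)) < \<delta> i)"
    and lims: "\<forall>i\<in>{1..N}. mat_tendsto n n (\<lambda>p. K p i) (Ks i) \<and>
      mat_tendsto n n (\<lambda>p. Q p i) (Qs i)"
    unfolding irl_output_def Let_def by (elim exE conjE) (rule that)
  have limK: "mat_tendsto n n (\<lambda>p. K p i) (Ks i)" and limQ: "mat_tendsto n n (\<lambda>p. Q p i) (Qs i)"
    if "i \<in> {1..N}" for i
    using lims that by auto
  have R: "pos_def (m i) (R i i)" "\<And>j. j \<in> {1..N} - {i} \<Longrightarrow> pos_semidef (m j) (R i j)"
    if "i \<in> {1..N}" for i
    using weights that by auto
  \<comment> \<open>All sampling times are nonnegative, and there the demonstrated controls obey the
    feedback law.\<close>
  have Fhat: "estimated_gain n m s t x u i = Fd i" if i: "i \<in> {1..N}" for i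
    using Fd[OF i] demonstration t rank i
    by (intro estimated_gain_eq) (auto simp: feedback_trajectory_def)
  have Rii: "R i i \<in> carrier_mat (m i) (m i)" "det (R i i) \<noteq> 0" if "i \<in> {1..N}" for i
    using R(1)[OF that] pos_def_det_nonzero by (auto simp: pos_def_def sym_mat_def)
  have V: "sym_mat (m i) (mat_inv (R i i))" if "i \<in> {1..N}" for i
    using R(1)[OF that] pos_def_det_nonzero by (auto simp: pos_def_def intro: sym_mat_mat_inv)
  have symR: "sym_mat (m j) (R i j)" if "i \<in> {1..N}" "j \<in> {1..N}" for i j
    using R(1)[OF that(1)] R(2)[OF that(1), of j] that
    by (cases "j = i") (auto simp: pos_def_def pos_semidef_def)
  define d where "d p i = gain B R (K p) i - Fd i" for p i
  have updK: "K (Suc p) i = K p i - \<alpha> i \<cdot>\<^sub>m ((d p i)\<^sup>T * mat_inv (R i i) * (B i)\<^sup>T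
      + B i * mat_inv (R i i) * d p i)" if "i \<in> {1..N}" for p i
    using upd that Fhat[OF that] unfolding update_phase_def Let_def d_def by simp
  \<comment> \<open>The start \<open>K 0\<close> is the Lyapunov solution accepted by the first
    phase, which is symmetric, and each update preserves symmetry. This supplies the dimensions of
    the iterates and the symmetry of their limit.\<close>
  have symK: "\<forall>i\<in>{1..N}. sym_mat n (K p i)" for p
  proof (induction p)
    case 0
    then show ?case using lyap unfolding lyapunov_phase_def by force
  next
    case (Suc p)
    show ?case
    proof
      fix i assume i: "i \<in> {1..N}"
      have K: "sym_mat n (K p i)" using Suc i by blast
      then have "d p i \<in> carrier_mat (m i) n"
        unfolding d_def using Fd[OF i] by (auto simp: sym_mat_def)
      then show "sym_mat n (K (Suc p) i)"
        unfolding updK[OF i] using K V[OF i] B[OF i] by (intro sym_mat_update)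
    qed
  qed
  have K: "K p i \<in> carrier_mat n n" if "i \<in> {1..N}" for p i
    using symK that by (auto simp: sym_mat_def)
  have F: "gain B R (K p) i \<in> carrier_mat (m i) n" if "i \<in> {1..N}" for p i
    using that by (intro gain_carrier Rii B K)
  have limF: "mat_tendsto (m i) n (\<lambda>p. gain B R (K p) i) (gain B R Ks i)" if "i \<in> {1..N}" for i
    using that by (intro mat_tendsto_gain Rii B K limK)
  have d: "d p i \<in> carrier_mat (m i) n" if "i \<in> {1..N}" for p i
    unfolding d_def using Fd[OF that] by auto
  have "gain B R Ks i - Fd i = 0\<^sub>m (m i) n"
  proof (rule mismatch_limit_zero[of N d m n "\<lambda>i. gain B R Ks i - Fd i" i])
    show "d p i \<in> carrier_mat (m i) n" if "i \<in> {1..N}" for p i using d[OF that] .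
    show "mat_tendsto (m i) n (\<lambda>p. d p i) (gain B R Ks i - Fd i)" if "i \<in> {1..N}" for i
      unfolding d_def using that by (intro mat_tendsto_minus limF mat_tendsto_const Fd)
    show "d (Suc p) i = 0\<^sub>m (m i) n"
      if zero: "\<And>j. j \<in> {1..N} \<Longrightarrow> d p j = 0\<^sub>m (m j) n" and i: "i \<in> {1..N}" for p i
    proof -
      \<comment> \<open>The correction is linear in the mismatch, so a zero mismatch leaves
        \<open>K\<close> and hence the gain unchanged.\<close>
      have "K (Suc p) i = K p i"
        unfolding updK[OF i] zero[OF i] using V[OF i] B[OF i] K[OF i, of p]
        by (intro eq_matI) (auto simp: sym_mat_def)
      then show ?thesis using zero[OF i] by (simp add: d_def gain_def)
    qed
    show "\<exists>p. \<forall>i\<in>{1..N}. mat_trace ((d p i)\<^sup>T * d p i) < \<delta> i"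
      if "\<And>i. i \<in> {1..N} \<Longrightarrow> \<delta> i > 0" for \<delta>
      using test[rule_format, of \<delta>] that by (simp add: d_def Fhat)
  qed (fact i)
  then have "(gain B R Ks i - Fd i) $$ (r, c) = 0" if "r < m i" "c < n" for r c
    using that by simp
  moreover have Fs: "gain B R Ks j \<in> carrier_mat (m j) n" if "j \<in> {1..N}" for j
    using limF[OF that] by (simp add: mat_tendsto_def)
  ultimately show "gain B R Ks i = Fd i"
    using Fd[OF i] Fs[OF i] by (intro eq_matI) auto
  show "pos_def (m i) (R i i)" using R(1) i .
  show "sym_mat (m j) (R i j)" if "j \<in> {1..N}" for j using symR i that .
  show "sym_mat n (Ks i)" using mat_tendsto_sym_mat[OF limK[OF i]] symK i by blast
  then have Ks: "Ks i \<in> carrier_mat n n" by (simp add: sym_mat_def)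
  show "Qs i \<in> carrier_mat n n" using limQ[OF i] by (simp add: mat_tendsto_def)
  \<comment> \<open>\<open>L\<close> is the right-hand side of the state-cost update as a function
    of the family \<open>K\<close>. Its continuity along the iterates carries the update formula
    over to the limit.\<close>
  define L where "L K = - (A\<^sup>T * K i) - K i * A
      - mat_sum n n {1..N} (\<lambda>j. (gain B R K j)\<^sup>T * R i j * gain B R K j)
      + mat_sum n n {1..N} (\<lambda>j. (gain B R K j)\<^sup>T * (B j)\<^sup>T) * K i
      + K i * mat_sum n n {1..N} (\<lambda>j. B j * gain B R K j)" for K
  have Rc: "R i j \<in> carrier_mat (m j) (m j)" if "j \<in> {1..N}" for j
    using symR[OF i that] by (simp add: sym_mat_def)
  have FT: "(gain B R (K p) j)\<^sup>T \<in> carrier_mat n (m j)" if "j \<in> {1..N}" for p j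
    using F[OF that] by simp
  have BT: "(B j)\<^sup>T \<in> carrier_mat (m j) n" if "j \<in> {1..N}" for j
    using B[OF that] by simp
  have AT: "A\<^sup>T \<in> carrier_mat n n" using A by simp
  have S1: "mat_tendsto n n
      (\<lambda>p. mat_sum n n {1..N} (\<lambda>j. (gain B R (K p) j)\<^sup>T * R i j * gain B R (K p) j))
      (mat_sum n n {1..N} (\<lambda>j. (gain B R Ks j)\<^sup>T * R i j * gain B R Ks j))"
  proof (rule mat_tendsto_sum)
    fix j assume j: "j \<in> {1..N}"
    show "mat_tendsto n n (\<lambda>p. (gain B R (K p) j)\<^sup>T * R i j * gain B R (K p) j)
      ((gain B R Ks j)\<^sup>T * R i j * gain B R Ks j)"
      by (intro mat_tendsto_mult[OF mat_tendsto_mult[OF mat_tendsto_transpose[OF limF F] FT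
              mat_tendsto_const[OF Rc] Rc] mult_carrier_mat[OF FT Rc] limF F] j)
  qed
  have S2: "mat_tendsto n n (\<lambda>p. mat_sum n n {1..N} (\<lambda>j. (gain B R (K p) j)\<^sup>T * (B j)\<^sup>T))
      (mat_sum n n {1..N} (\<lambda>j. (gain B R Ks j)\<^sup>T * (B j)\<^sup>T))"
  proof (rule mat_tendsto_sum)
    fix j assume j: "j \<in> {1..N}"
    show "mat_tendsto n n (\<lambda>p. (gain B R (K p) j)\<^sup>T * (B j)\<^sup>T) ((gain B R Ks j)\<^sup>T * (B j)\<^sup>T)"
      by (intro mat_tendsto_mult[OF mat_tendsto_transpose[OF limF F] FT
            mat_tendsto_const[OF BT] BT] j)
  qed
  have S3: "mat_tendsto n n (\<lambda>p. mat_sum n n {1..N} (\<lambda>j. B j * gain B R (K p) j))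
      (mat_sum n n {1..N} (\<lambda>j. B j * gain B R Ks j))"
  proof (rule mat_tendsto_sum)
    fix j assume j: "j \<in> {1..N}"
    show "mat_tendsto n n (\<lambda>p. B j * gain B R (K p) j) (B j * gain B R Ks j)"
      by (intro mat_tendsto_mult[OF mat_tendsto_const[OF B] B limF F] j)
  qed
  have "mat_tendsto n n (\<lambda>p. L (K p)) (L Ks)"
    unfolding L_def
    by (intro mat_tendsto_add mat_tendsto_minus mat_tendsto_uminus S1 S2 S3 mat_sum_carrier
        mat_tendsto_mult[OF mat_tendsto_const[OF AT] AT limK[OF i] K[OF i]]
        mat_tendsto_mult[OF limK[OF i] K[OF i] mat_tendsto_const[OF A] A]
        mat_tendsto_mult[OF S2 mat_sum_carrier limK[OF i] K[OF i]]
        mat_tendsto_mult[OF limK[OF i] K[OF i] S3 mat_sum_carrier]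
        mult_carrier_mat[OF AT K[OF i]] mult_carrier_mat[OF K[OF i] A]
        mult_carrier_mat[OF mat_sum_carrier K[OF i]] mult_carrier_mat[OF K[OF i] mat_sum_carrier])
  \<comment> \<open>The shift is essential: \<open>Q 0\<close> is a free initialization, and only
    \<open>Q (Suc p)\<close> is given by \<open>L\<close>.\<close>
  from mat_tendsto_Suc[OF this] have "mat_tendsto n n (\<lambda>p. L (K (Suc p))) (L Ks)" .
  moreover have "Q (Suc p) i = L (K (Suc p))" for p
    using upd i unfolding update_phase_def Let_def L_def by blast
  ultimately have "Qs i = L Ks"
    using mat_tendsto_unique[OF mat_tendsto_Suc[OF limQ[OF i]]] by simp
  then show "are_lhs n N A B Qs R Ks i = 0\<^sub>m n n"
    using A Ks unfolding L_def by (intro are_lhs_zero_of_limit)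
qed

section \<open>Equivalence of the modified game\<close>

theorem mainTheorem4:
  fixes n N :: nat and m :: "nat \<Rightarrow> nat"
    and A :: "real mat" and B :: "nat \<Rightarrow> real mat"
    and Qd Kd Qs Ks Fs Q' K' :: "nat \<Rightarrow> real mat"
    and Rd R R' :: "nat \<Rightarrow> nat \<Rightarrow> real mat"
    and x :: "real \<Rightarrow> real vec" and u :: "nat \<Rightarrow> real \<Rightarrow> real vec"
  assumes observed: "lq_game n m N A B Qd Rd"
    and observed_solution: "stabilizing_are_solution n N A B Qd Rd Kd"
    and demonstration: "feedback_trajectory n N A B (gain B Rd Kd) x u"
    and algorithm_output: "irl_output n m N A B x u Qs R Ks"
    and Fs: "\<And>i. i \<in> {1..N} \<Longrightarrow> Fs i = gain B R Ks i"
    and delta_K: "\<And>i. i \<in> {1..N} \<Longrightarrow> K' i = Ks i"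
    and delta_R: "\<And>i. i \<in> {1..N} \<Longrightarrow> R' i i = R i i"
    and Q'_sym: "\<And>i. i \<in> {1..N} \<Longrightarrow> sym_mat n (Q' i)"
    and R'_sym: "\<And>i j. i \<in> {1..N} \<Longrightarrow> j \<in> {1..N} \<Longrightarrow> j \<noteq> i \<Longrightarrow> sym_mat (m j) (R' i j)"
    and balance: "\<And>i. i \<in> {1..N} \<Longrightarrow>
      (Qs i - Q' i) + mat_sum n n ({1..N} - {i}) (\<lambda>j. (Fs j)\<^sup>T * (R i j - R' i j) * Fs j) = 0\<^sub>m n n"
  shows "lq_game n m N A B Q' R' \<and>
    stabilizing_are_solution n N A B Q' R' K' \<and>
    equivalent_game n N A B Q' R' Rd Kd"
proof -
  have A: "A \<in> carrier_mat n n"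
    and B: "\<And>i. i \<in> {1..N} \<Longrightarrow> B i \<in> carrier_mat n (m i)"
    and Rd: "\<And>i. i \<in> {1..N} \<Longrightarrow> pos_def (m i) (Rd i i)"
    using observed by (auto simp: lq_game_def)
  have Kd: "Kd i \<in> carrier_mat n n" if "i \<in> {1..N}" for i
    using observed_solution that by (auto simp: stabilizing_are_solution_def sym_mat_def)
  have Fd: "gain B Rd Kd i \<in> carrier_mat (m i) n" if "i \<in> {1..N}" for i
    using Rd[OF that] pos_def_det_nonzero that
    by (intro gain_carrier B Kd) (auto simp: pos_def_def sym_mat_def)
  from B Fd have "\<forall>i\<in>{1..N}. B i \<in> carrier_mat n (m i)"
    "\<forall>i\<in>{1..N}. gain B Rd Kd i \<in> carrier_mat (m i) n" by blast+
  note out = irl_output_properties[OF A this demonstration algorithm_output]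
  \<comment> \<open>A gain sees the control weights only through the diagonal block
    \<open>R i i\<close>, which is kept together with \<open>Ks i\<close>.\<close>
  have gains: "gain B R' K' i = gain B R Ks i" if "i \<in> {1..N}" for i
    using delta_K[OF that] delta_R[OF that] by (simp add: gain_def)
  have R': "sym_mat (m j) (R' i j)" if "i \<in> {1..N}" "j \<in> {1..N}" for i j
    using R'_sym[OF that] delta_R[OF that(1)] out(2)[OF that] by (cases "j = i") auto
  have game: "lq_game n m N A B Q' R'"
    unfolding lq_game_def using A B Q'_sym R' out(1) delta_R by auto
  have "are_lhs n N A B Q' R' K' i = 0\<^sub>m n n" if i: "i \<in> {1..N}" for i
  proof -
    \<comment> \<open>\<open>Fs\<close> is tied to the gains only at players, so the replacement is
      made under the sum.\<close>
    have "mat_sum n n ({1..N} - {i}) (\<lambda>j. (Fs j)\<^sup>T * (R i j - R' i j) * Fs j)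
      = mat_sum n n ({1..N} - {i}) (\<lambda>j. (gain B R Ks j)\<^sup>T * (R i j - R' i j) * gain B R Ks j)"
      by (intro mat_sum_cong) (simp add: Fs)
    note bal = balance[OF i, unfolded this]
    have "are_lhs n N A B Q' R' K' i = are_lhs n N A B Qs R Ks i"
    proof (rule are_lhs_balance[where m = m])
      show "gain B R Ks j \<in> carrier_mat (m j) n" if "j \<in> {1..N}" for j
        using out(5)[OF that] Fd[OF that] by simp
    qed (use A i out(2,3)[OF i] out(4)[OF i] R' gains delta_K delta_R Q'_sym bal
        in \<open>auto simp: sym_mat_def\<close>)
    with out(6)[OF i] show ?thesis by simp
  qed
  \<comment> \<open>The closed loop depends on the costs only through the gains, so the new one is
    the observed one and is stable by assumption.\<close>
  moreover have "closed_loop n N A B (gain B R' K') = closed_loop n N A B (gain B Rd Kd)"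
    unfolding closed_loop_def using gains out(5)
    by (intro arg_cong[where f = "\<lambda>M. A - M"] mat_sum_cong) auto
  ultimately have sol: "stabilizing_are_solution n N A B Q' R' K'"
    using observed_solution out(3) delta_K by (auto simp: stabilizing_are_solution_def)
  \<comment> \<open>The witness is \<open>K'\<close>; its gains equal those of \<open>Ks\<close>,
    which match the demonstrated ones.\<close>
  then have "equivalent_game n N A B Q' R' Rd Kd"
    unfolding equivalent_game_def using gains out(5) by auto
  with game sol show ?thesis by blast
qed

end
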